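(* (a) Let $\mathcal{A}$ be a unital associative complex algebra, let $\mathcal{M}$ be a unital $\mathcal{A}$-bimodule, and let $\mathcal{J}$ be a (two-sided) ideal of $\mathcal{A}$ such that $\mathcal{J}\subseteq \mathfrak{I}(\mathcal{A})$ and $\{m\in\mathcal{M} \mid xm=mx=0 \text{ for all } x\in\mathcal{J}\}=\{0\}$. Let $D:\mathcal{A}\to\mathcal{M}$ be a linear map such that for all $a,b\in\mathcal{A}$, $$ab=0 \ \Rightarrow\ aD(b)+D(a)b=0.$$ Then $D$ is a generalized derivation and $aD(1)=D(1)a$ for all $a\in\mathcal{A}$. (b) Let $\mathcal{A}$ be a unital complex Banach algebra, let $\mathcal{M}$ be a unital Banach $\mathcal{A}$-bimodule, and let $\mathcal{J}$ be a (two-sided) ideal of $\mathcal{A}$ such that $\mathcal{J}\subseteq \overline{\mathfrak{I}(\mathcal{A})}$ and $\{m\in\mathcal{M} \mid xm=mx=0 \text{ for all } x\in\mathcal{J}\}=\{0\}$. Let $D:\mathcal{A}\to\mathcal{M}$ be a continuous linear map such that for all $a,b\in\mathcal{A}$, $ab=0$ implies $aD(b)+D(a)b=0$. Then $D$ is a generalized derivation and $aD(1)=D(1)a$ for all $a\in\mathcal{A}$.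
   Context: All algebras are associative and unital over $\mathbb{C}$, and all modules are unital. $\mathfrak{I}(\mathcal{A})$ denotes the set of all (finite) linear combinations of idempotents of $\mathcal{A}$; $\overline{\mathfrak{I}(\mathcal{A})}$ is its norm closure. A linear map $D:\mathcal{A}\to\mathcal{M}$ is a generalized derivation if $D(ab)=D(a)b+aD(b)-aD(1)b$ for all $a,b\in\mathcal{A}$. *)

theory Defs
  imports "HOL-Analysis.Analysis"
begin

text \<open>
  The complex scalar multiplication is an explicit parameter, since the library has no
  type class of complex algebras. The sort \<open>{ring, monoid_mult}\<close> is used instead of
  \<open>ring_1\<close> because the latter excludes the zero algebra by demanding \<open>0 \<noteq> 1\<close>.
\<close>

locale complex_algebra = vector_space scale
  for scale :: "complex \<Rightarrow> 'a::{ring,monoid_mult} \<Rightarrow> 'a" +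
  assumes scale_mult_left: "scale c x * y = scale c (x * y)"
    and scale_mult_right: "x * scale c y = scale c (x * y)"

text \<open>
  The type class \<open>banach\<close> provides a norm and a real scalar multiplication only; the
  assumptions say that they come from the complex structure.
\<close>

locale complex_banach_space = vector_space scale
  for scale :: "complex \<Rightarrow> 'a::banach \<Rightarrow> 'a" +
  assumes scale_of_real: "scale (of_real r) x = r *\<^sub>R x"
    and norm_scale: "norm (scale c x) = cmod c * norm x"

text \<open>
  The norm of the sort \<open>real_normed_algebra\<close> is submultiplicative. The norm of the unit is
  not required to be \<open>1\<close>, as it would be in \<open>real_normed_algebra_1\<close>.
\<close>

locale complex_banach_algebra = complex_algebra scale + complex_banach_space scale
  for scale :: "complex \<Rightarrow> 'a::{real_normed_algebra,monoid_mult,banach} \<Rightarrow> 'a"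

locale unital_bimodule = A: complex_algebra scaleA + M: vector_space scaleM
  for scaleA :: "complex \<Rightarrow> 'a::{ring,monoid_mult} \<Rightarrow> 'a"
    and scaleM :: "complex \<Rightarrow> 'm::ab_group_add \<Rightarrow> 'm" +
  fixes lact :: "'a \<Rightarrow> 'm \<Rightarrow> 'm"
    and ract :: "'m \<Rightarrow> 'a \<Rightarrow> 'm"
  assumes lact_add_left: "lact (a + b) m = lact a m + lact b m"
    and lact_add_right: "lact a (m + n) = lact a m + lact a n"
    and lact_scale_left: "lact (scaleA c a) m = scaleM c (lact a m)"
    and lact_scale_right: "lact a (scaleM c m) = scaleM c (lact a m)"
    and lact_mult: "lact (a * b) m = lact a (lact b m)"
    and lact_one: "lact 1 m = m"
    and ract_add_left: "ract (m + n) a = ract m a + ract n a"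
    and ract_add_right: "ract m (a + b) = ract m a + ract m b"
    and ract_scale_left: "ract (scaleM c m) a = scaleM c (ract m a)"
    and ract_scale_right: "ract m (scaleA c a) = scaleM c (ract m a)"
    and ract_mult: "ract m (a * b) = ract (ract m a) b"
    and ract_one: "ract m 1 = m"
    and lact_ract: "ract (lact a m) b = lact a (ract m b)"

text \<open>
  The module actions of a Banach bimodule are bounded, with no requirement that the bound
  be \<open>1\<close>.
\<close>

locale unital_banach_bimodule =
  unital_bimodule scaleA scaleM lact ract +
  A: complex_banach_algebra scaleA + M: complex_banach_space scaleM
  for scaleA :: "complex \<Rightarrow> 'a::{real_normed_algebra,monoid_mult,banach} \<Rightarrow> 'a"
    and scaleM :: "complex \<Rightarrow> 'm::banach \<Rightarrow> 'm"
    and lact :: "'a \<Rightarrow> 'm \<Rightarrow> 'm"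
    and ract :: "'m \<Rightarrow> 'a \<Rightarrow> 'm" +
  assumes lact_bounded: "\<exists>K. \<forall>a m. norm (lact a m) \<le> K * norm a * norm m"
    and ract_bounded: "\<exists>K. \<forall>m a. norm (ract m a) \<le> K * norm m * norm a"

definition two_sided_ideal ::
    "(complex \<Rightarrow> 'a::{ring,monoid_mult} \<Rightarrow> 'a) \<Rightarrow> 'a set \<Rightarrow> bool" where
  "two_sided_ideal scaleA J \<longleftrightarrow>
     module.subspace scaleA J \<and> (\<forall>a. \<forall>x\<in>J. a * x \<in> J \<and> x * a \<in> J)"

definition idempotent_span ::
    "(complex \<Rightarrow> 'a::{ring,monoid_mult} \<Rightarrow> 'a) \<Rightarrow> 'a set" where
  "idempotent_span scaleA = module.span scaleA {p. p * p = p}"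

definition generalized_derivation ::
    "(complex \<Rightarrow> 'a::{ring,monoid_mult} \<Rightarrow> 'a) \<Rightarrow> (complex \<Rightarrow> 'm::ab_group_add \<Rightarrow> 'm) \<Rightarrow>
     ('a \<Rightarrow> 'm \<Rightarrow> 'm) \<Rightarrow> ('m \<Rightarrow> 'a \<Rightarrow> 'm) \<Rightarrow> ('a \<Rightarrow> 'm) \<Rightarrow> bool" where
  "generalized_derivation scaleA scaleM lact ract D \<longleftrightarrow>
     Vector_Spaces.linear scaleA scaleM D \<and>
     (\<forall>a b. D (a * b) = ract (D a) b + lact a (D b) - ract (lact a (D 1)) b)"

end

theory Submission
  imports Defs
begin

text \<open>
  Write \<open>\<phi>(a, b) = a D(b) + D(a) b\<close>, a bilinear map that vanishes whenever \<open>a b = 0\<close>.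
  An idempotent \<open>p\<close> provides zero products: \<open>(a p)((1 - p) b) = 0\<close> and
  \<open>(a (1 - p))(p b) = 0\<close>, whence \<open>\<phi>(a p, b) = \<phi>(a p, p b) = \<phi>(a, p b)\<close>. The elements
  \<open>x\<close> that can be moved across \<open>\<phi>\<close> in this way, so that \<open>\<phi>(a x, b) = \<phi>(a, x b)\<close> for all
  \<open>a\<close> and \<open>b\<close>, form a subspace, because \<open>\<phi>\<close> is bilinear, and this subspace is closed if \<open>D\<close>
  is continuous. As it contains all idempotents, it contains the ideal \<open>J\<close> in both parts of
  the theorem.

  The rest is algebra. For \<open>x \<in> J\<close>, moving \<open>x\<close> across \<open>\<phi>\<close> with one or both of the outer
  arguments equal to \<open>1\<close> gives \<open>x D(1) = D(1) x\<close> and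
  \<open>D(x b) = x D(b) + D(x) b - D(1) x b\<close>, together with the mirror image for \<open>D(a x)\<close>.
  Since \<open>J\<close> is an ideal, \<open>x D(1) = D(1) x\<close> also holds for \<open>x a\<close> and \<open>a x\<close>, which shows that
  \<open>a D(1) - D(1) a\<close> is annihilated by \<open>J\<close> on both sides and hence is zero. Expanding
  \<open>D(x a b)\<close> as \<open>D(x (a b))\<close> and as \<open>D((x a) b)\<close> shows that the defect
  \<open>D(a b) - D(a) b - a D(b) + a D(1) b\<close> is annihilated by \<open>J\<close> on the left; expanding
  \<open>D(a b x)\<close> in two ways does the same on the right. So the defect is zero as well.
\<close>

section \<open>Elements that move across the Leibniz form\<close>

context unital_bimodule
begin

lemma lact_diff_left: "lact (a - b) m = lact a m - lact b m"
  using lact_add_left[of "a - b" b m] by (simp add: algebra_simps)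

lemma lact_diff_right: "lact a (m - n) = lact a m - lact a n"
  using lact_add_right[of a "m - n" n] by (simp add: algebra_simps)

lemma ract_diff_left: "ract (m - n) a = ract m a - ract n a"
  using ract_add_left[of "m - n" n a] by (simp add: algebra_simps)

lemma ract_diff_right: "ract m (a - b) = ract m a - ract m b"
  using ract_add_right[of m "a - b" b] by (simp add: algebra_simps)

definition leibniz_form :: "('a \<Rightarrow> 'm) \<Rightarrow> 'a \<Rightarrow> 'a \<Rightarrow> 'm" where
  "leibniz_form D a b = lact a (D b) + ract (D a) b"

definition balancing :: "('a \<Rightarrow> 'm) \<Rightarrow> 'a set" where
  "balancing D = {x. \<forall>a b. leibniz_form D (a * x) b = leibniz_form D a (x * b)}"

lemma balancing_iff:
  "x \<in> balancing D \<longleftrightarrow>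
    (\<forall>a b. lact (a * x) (D b) + ract (D (a * x)) b = lact a (D (x * b)) + ract (D a) (x * b))"
  by (simp add: balancing_def leibniz_form_def)

lemma leibniz_form_diff_left:
  assumes "Vector_Spaces.linear scaleA scaleM D"
  shows "leibniz_form D (a - b) c = leibniz_form D a c - leibniz_form D b c"
proof -
  interpret D: Vector_Spaces.linear scaleA scaleM D by fact
  show ?thesis
    by (simp add: leibniz_form_def D.diff lact_diff_left ract_diff_left)
qed

lemma leibniz_form_diff_right:
  assumes "Vector_Spaces.linear scaleA scaleM D"
  shows "leibniz_form D a (b - c) = leibniz_form D a b - leibniz_form D a c"
proof -
  interpret D: Vector_Spaces.linear scaleA scaleM D by fact
  show ?thesis
    by (simp add: leibniz_form_def D.diff lact_diff_right ract_diff_right)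
qed

text \<open>
  An idempotent \<open>p\<close> splits each argument of the form into two pieces, and the mixed pieces
  \<open>a p, (1 - p) b\<close> and \<open>a (1 - p), p b\<close> have zero product. So both \<open>\<phi>(a p, b)\<close> and
  \<open>\<phi>(a, p b)\<close> reduce to \<open>\<phi>(a p, p b)\<close>.
\<close>

lemma idempotent_in_balancing:
  assumes lin: "Vector_Spaces.linear scaleA scaleM D"
    and zero_product: "\<And>a b. a * b = 0 \<Longrightarrow> lact a (D b) + ract (D a) b = 0"
    and idem: "p * p = p"
  shows "p \<in> balancing D"
proof -
  have vanish: "leibniz_form D a b = 0" if "a * b = 0" for a b
    using zero_product[OF that] by (simp add: leibniz_form_def)
  have "leibniz_form D (a * p) b = leibniz_form D a (p * b)" for a b
  proof -
    have absorb: "p * (p * b) = p * b"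
      by (simp add: idem flip: mult.assoc)
    have "leibniz_form D (a * p) (b - p * b) = 0"
      by (rule vanish) (simp add: right_diff_distrib mult.assoc absorb)
    moreover have "leibniz_form D (a - a * p) (p * b) = 0"
      by (rule vanish) (simp add: left_diff_distrib mult.assoc absorb)
    ultimately show ?thesis
      by (simp add: leibniz_form_diff_left[OF lin] leibniz_form_diff_right[OF lin])
  qed
  then show ?thesis
    by (simp add: balancing_def)
qed

lemma subspace_balancing:
  assumes "Vector_Spaces.linear scaleA scaleM D"
  shows "A.subspace (balancing D)"
proof -
  interpret D: Vector_Spaces.linear scaleA scaleM D by fact
  have zeros: "lact 0 m = 0" "ract m 0 = 0" "lact a 0 = 0" "ract 0 a = 0" for a m
    using lact_diff_left[of 0 0 m] ract_diff_right[of m 0 0]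
      lact_diff_right[of a 0 0] ract_diff_left[of 0 0 a] by simp_all
  show ?thesis
  proof (rule A.subspaceI)
    show "0 \<in> balancing D"
      by (simp add: balancing_iff zeros D.zero)
  next
    fix x y
    assume "x \<in> balancing D" "y \<in> balancing D"
    then have
      "lact (a * x) (D b) + ract (D (a * x)) b = lact a (D (x * b)) + ract (D a) (x * b)"
      "lact (a * y) (D b) + ract (D (a * y)) b = lact a (D (y * b)) + ract (D a) (y * b)"
      for a b
      by (simp_all add: balancing_iff)
    then have
      "(lact (a * x) (D b) + ract (D (a * x)) b) + (lact (a * y) (D b) + ract (D (a * y)) b)
       = (lact a (D (x * b)) + ract (D a) (x * b)) + (lact a (D (y * b)) + ract (D a) (y * b))"
      for a b
      by simp
    then show "x + y \<in> balancing D"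
      by (simp add: balancing_iff distrib_left distrib_right D.add lact_add_left
          lact_add_right ract_add_left ract_add_right ac_simps)
  next
    fix c x
    assume "x \<in> balancing D"
    then show "scaleA c x \<in> balancing D"
      by (simp add: balancing_iff A.scale_mult_left A.scale_mult_right D.scale lact_scale_left
          lact_scale_right ract_scale_left ract_scale_right flip: M.scale_right_distrib)
  qed
qed

lemma idempotent_span_subset_balancing:
  assumes "Vector_Spaces.linear scaleA scaleM D"
    and "\<And>a b. a * b = 0 \<Longrightarrow> lact a (D b) + ract (D a) b = 0"
  shows "idempotent_span scaleA \<subseteq> balancing D"
  unfolding idempotent_span_def
  using idempotent_in_balancing[OF assms] subspace_balancing[OF assms(1)]
  by (intro A.span_minimal) auto

section \<open>Generalized derivations from an ideal with trivial annihilator\<close>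

lemma eq_if_annihilated:
  assumes "{m. \<forall>x\<in>J. lact x m = 0 \<and> ract m x = 0} = {0}"
    and "\<And>x. x \<in> J \<Longrightarrow> lact x m = lact x n"
    and "\<And>x. x \<in> J \<Longrightarrow> ract m x = ract n x"
  shows "m = n"
proof -
  have "m - n \<in> {m. \<forall>x\<in>J. lact x m = 0 \<and> ract m x = 0}"
    using assms(2,3) by (simp add: lact_diff_right ract_diff_left)
  then show ?thesis
    unfolding assms(1) by simp
qed

text \<open>
  Inside the ideal, \<open>D\<close> obeys two one-sided product rules and commutes with \<open>D(1)\<close>; all three
  are the balancing identity with \<open>1\<close> in an outer slot. The ideal property lets them be
  applied to \<open>x a\<close> and \<open>a x\<close> too, and comparing the resulting expansions proves each claim
  after multiplication by an arbitrary element of the ideal.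
\<close>

lemma generalized_derivation_if_balanced:
  assumes lin: "Vector_Spaces.linear scaleA scaleM D"
    and ideal: "two_sided_ideal scaleA J"
    and annihilator: "{m. \<forall>x\<in>J. lact x m = 0 \<and> ract m x = 0} = {0}"
    and balanced: "J \<subseteq> balancing D"
  shows "generalized_derivation scaleA scaleM lact ract D \<and>
    (\<forall>a. lact a (D 1) = ract (D 1) a)"
proof -
  have in_J: "x * a \<in> J" "a * x \<in> J" if "x \<in> J" for x a
    using ideal that by (auto simp: two_sided_ideal_def)
  have balance:
    "lact (a * x) (D b) + ract (D (a * x)) b = lact a (D (x * b)) + ract (D a) (x * b)"
    if "x \<in> J" for a x b
    using balanced that by (auto simp: balancing_iff)
  have central_J: "lact x (D 1) = ract (D 1) x" if "x \<in> J" for x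
    using balance[OF that, of 1 1] by (simp add: lact_one ract_one add.commute)
  have D_left: "D (x * b) = lact x (D b) + ract (D x) b - ract (ract (D 1) x) b"
    if "x \<in> J" for x b
    using balance[OF that, of 1 b] by (simp add: lact_one ract_mult eq_diff_eq)
  have D_right: "D (a * x) = lact a (D x) + ract (D a) x - lact a (lact x (D 1))"
    if "x \<in> J" for a x
    using balance[OF that, of a 1] by (simp add: ract_one lact_mult eq_diff_eq add.commute)
  have central: "lact a (D 1) = ract (D 1) a" for a
  proof (rule eq_if_annihilated[OF annihilator])
    fix x assume x: "x \<in> J"
    show "lact x (lact a (D 1)) = lact x (ract (D 1) a)"
      using central_J[OF in_J(1)[OF x], of a] central_J[OF x]
      by (simp add: lact_mult ract_mult flip: lact_ract)
    show "ract (lact a (D 1)) x = ract (ract (D 1) a) x"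
      using central_J[OF in_J(2)[OF x], of a] central_J[OF x]
      by (simp add: lact_mult ract_mult lact_ract)
  qed
  have "D (a * b) = ract (D a) b + lact a (D b) - ract (lact a (D 1)) b" for a b
  proof (rule eq_if_annihilated[OF annihilator])
    fix x assume x: "x \<in> J"
    have "lact x (D (a * b)) + ract (D x) (a * b) - ract (ract (D 1) x) (a * b)
        = lact (x * a) (D b) + ract (D (x * a)) b - ract (ract (D 1) (x * a)) b"
      using D_left[OF x, of "a * b"] D_left[OF in_J(1)[OF x], of a b]
      by (simp add: mult.assoc)
    then show "lact x (D (a * b))
        = lact x (ract (D a) b + lact a (D b) - ract (lact a (D 1)) b)"
      by (simp add: D_left[OF x] central lact_mult ract_mult lact_add_right lact_diff_right
          ract_add_left ract_diff_left algebra_simps flip: lact_ract)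
    have "lact (a * b) (D x) + ract (D (a * b)) x - lact (a * b) (lact x (D 1))
        = lact a (D (b * x)) + ract (D a) (b * x) - lact a (lact (b * x) (D 1))"
      using D_right[OF x, of "a * b"] D_right[OF in_J(2)[OF x], of a b]
      by (simp add: mult.assoc)
    then show "ract (D (a * b)) x
        = ract (ract (D a) b + lact a (D b) - ract (lact a (D 1)) b) x"
      by (simp add: D_right[OF x] lact_mult ract_mult lact_add_right lact_diff_right
          ract_add_left ract_diff_left lact_ract algebra_simps flip: central)
  qed
  with lin central show ?thesis
    by (simp add: generalized_derivation_def)
qed

end

section \<open>Continuity of the module actions\<close>

context unital_banach_bimodule
begin

lemma bounded_bilinear_lact: "bounded_bilinear lact"
proof
  show "\<exists>K. \<forall>a m. norm (lact a m) \<le> norm a * norm m * K"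
    using lact_bounded by (simp add: ac_simps)
qed (simp_all add: lact_add_left lact_add_right lact_scale_left lact_scale_right
    flip: A.scale_of_real M.scale_of_real)

lemma bounded_bilinear_ract: "bounded_bilinear ract"
proof
  show "\<exists>K. \<forall>m a. norm (ract m a) \<le> norm m * norm a * K"
    using ract_bounded by (simp add: ac_simps)
qed (simp_all add: ract_add_left ract_add_right ract_scale_left ract_scale_right
    flip: A.scale_of_real M.scale_of_real)

lemma closed_balancing:
  assumes D: "continuous_on UNIV D"
  shows "closed (balancing D)"
proof -
  note continuous_lact = bounded_bilinear.continuous_on[OF bounded_bilinear_lact]
    and continuous_ract = bounded_bilinear.continuous_on[OF bounded_bilinear_ract]
  have continuous_D: "continuous_on UNIV (\<lambda>x. D (f x))" if "continuous_on UNIV f" for f :: "'a \<Rightarrow> 'a"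
    using continuous_on_compose2[OF D that] by simp
  show ?thesis
    unfolding balancing_def leibniz_form_def
    by (intro closed_Collect_all closed_Collect_eq continuous_on_add continuous_lact
        continuous_ract continuous_D continuous_on_mult continuous_on_const continuous_on_id)
qed

end

section \<open>Maps with a Leibniz rule at zero products\<close>

theorem theorem4p1:
  fixes scaleA :: "complex \<Rightarrow> 'a::{ring,monoid_mult} \<Rightarrow> 'a"
    and scaleM :: "complex \<Rightarrow> 'm::ab_group_add \<Rightarrow> 'm"
    and lactM :: "'a \<Rightarrow> 'm \<Rightarrow> 'm" and ractM :: "'m \<Rightarrow> 'a \<Rightarrow> 'm"
    and J :: "'a set" and D :: "'a \<Rightarrow> 'm"
    and scaleB :: "complex \<Rightarrow> 'b::{real_normed_algebra,monoid_mult,banach} \<Rightarrow> 'b"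
    and scaleN :: "complex \<Rightarrow> 'n::banach \<Rightarrow> 'n"
    and lactN :: "'b \<Rightarrow> 'n \<Rightarrow> 'n" and ractN :: "'n \<Rightarrow> 'b \<Rightarrow> 'n"
    and I :: "'b set" and E :: "'b \<Rightarrow> 'n"
  shows
    "(unital_bimodule scaleA scaleM lactM ractM \<and>
      two_sided_ideal scaleA J \<and>
      J \<subseteq> idempotent_span scaleA \<and>
      {m. \<forall>x\<in>J. lactM x m = 0 \<and> ractM m x = 0} = {0} \<and>
      Vector_Spaces.linear scaleA scaleM D \<and>
      (\<forall>a b. a * b = 0 \<longrightarrow> lactM a (D b) + ractM (D a) b = 0)
      \<longrightarrow>
      generalized_derivation scaleA scaleM lactM ractM D \<and>
      (\<forall>a. lactM a (D 1) = ractM (D 1) a))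
     \<and>
     (unital_banach_bimodule scaleB scaleN lactN ractN \<and>
      two_sided_ideal scaleB I \<and>
      I \<subseteq> closure (idempotent_span scaleB) \<and>
      {m. \<forall>x\<in>I. lactN x m = 0 \<and> ractN m x = 0} = {0} \<and>
      Vector_Spaces.linear scaleB scaleN E \<and>
      continuous_on UNIV E \<and>
      (\<forall>a b. a * b = 0 \<longrightarrow> lactN a (E b) + ractN (E a) b = 0)
      \<longrightarrow>
      generalized_derivation scaleB scaleN lactN ractN E \<and>
      (\<forall>a. lactN a (E 1) = ractN (E 1) a))"
proof (intro conjI[of "_ \<longrightarrow> _"] impI; elim conjE)
  assume "unital_bimodule scaleA scaleM lactM ractM"
    and ideal: "two_sided_ideal scaleA J"
    and span: "J \<subseteq> idempotent_span scaleA"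
    and annihilator: "{m. \<forall>x\<in>J. lactM x m = 0 \<and> ractM m x = 0} = {0}"
    and lin: "Vector_Spaces.linear scaleA scaleM D"
    and zero_product: "\<forall>a b. a * b = 0 \<longrightarrow> lactM a (D b) + ractM (D a) b = 0"
  then interpret unital_bimodule scaleA scaleM lactM ractM by simp
  have "J \<subseteq> balancing D"
    using span idempotent_span_subset_balancing[OF lin] zero_product by blast
  then show "generalized_derivation scaleA scaleM lactM ractM D \<and>
      (\<forall>a. lactM a (D 1) = ractM (D 1) a)"
    by (rule generalized_derivation_if_balanced[OF lin ideal annihilator])
next
  assume "unital_banach_bimodule scaleB scaleN lactN ractN"
    and ideal: "two_sided_ideal scaleB I"
    and span: "I \<subseteq> closure (idempotent_span scaleB)"
    and annihilator: "{m. \<forall>x\<in>I. lactN x m = 0 \<and> ractN m x = 0} = {0}"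
    and lin: "Vector_Spaces.linear scaleB scaleN E"
    and continuous: "continuous_on UNIV E"
    and zero_product: "\<forall>a b. a * b = 0 \<longrightarrow> lactN a (E b) + ractN (E a) b = 0"
  then interpret unital_banach_bimodule scaleB scaleN lactN ractN by simp
  have "closure (idempotent_span scaleB) \<subseteq> balancing E"
    using idempotent_span_subset_balancing[OF lin] zero_product closed_balancing[OF continuous]
    by (intro closure_minimal) blast+
  with span have "I \<subseteq> balancing E"
    by (rule subset_trans)
  then show "generalized_derivation scaleB scaleN lactN ractN E \<and>
      (\<forall>a. lactN a (E 1) = ractN (E 1) a)"
    by (rule generalized_derivation_if_balanced[OF lin ideal annihilator])
qed

end
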